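(* Let $0<q<1$ and $l>0$. Let $I_3$ be the closure in $\mathcal H_l$ of the symmetric operator defined on the linear span of the basis $f^l_n$, $n\ge0$, by $$I_3=-\frac12\,q^{-3J_0/4}(J_++J_-)q^{-3J_0/4}+\frac{1+q}{2(1-q)}\,q^{-2J_0}-\frac{q^l+q^{1-l}}{2(1-q)}\,q^{-J_0}.$$ Then the closed symmetric operator $I_3$ is not selfadjoint and has deficiency indices $(1,1)$.
   Context: Notation: $(a;q)_n=\prod_{r=0}^{n-1}(1-aq^r)$, $[c]_q=\frac{q^{c/2}-q^{-c/2}}{q^{1/2}-q^{-1/2}}$. Discrete series representation $T_l^+$ of $U_q(\mathrm{su}_{1,1})$ ($l>0$): $\mathcal H_l$ is the Hilbert space with orthonormal basis the monomials $f^l_n(x;q)=c^l_n(q)x^n$, $n=0,1,2,\dots$, where $c^l_n(q)=q^{(1-2l)n/4}\left(\frac{(q^{2l};q)_n}{(q;q)_n}\right)^{1/2}$. The operators act by $J_0f^l_n=(l+n)f^l_n$, $J_+f^l_n=\sqrt{[2l+n]_q[n+1]_q}\,f^l_{n+1}$, $J_-f^l_n=\sqrt{[2l+n-1]_q[n]_q}\,f^l_{n-1}$, and $q^{cJ_0}f^l_n=q^{c(l+n)}f^l_n$. *)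

theory Defs
  imports "HOL-Analysis.Analysis" "HOL-Computational_Algebra.Formal_Power_Series"
begin

section \<open>The Hilbert space\<close>

definition qpoch :: "real \<Rightarrow> real \<Rightarrow> nat \<Rightarrow> real" where
  "qpoch a q n = (\<Prod>r<n. 1 - a * q ^ r)"

definition qnum :: "real \<Rightarrow> real \<Rightarrow> real" where
  "qnum q c = (q powr (c / 2) - q powr (- c / 2)) / (q powr (1 / 2) - q powr (- 1 / 2))"

definition fcoef :: "real \<Rightarrow> real \<Rightarrow> nat \<Rightarrow> real" where
  "fcoef q l n = q powr ((1 - 2 * l) * real n / 4) * sqrt (qpoch (q powr (2 * l)) q n / qpoch q q n)"

definition cscale :: "complex \<Rightarrow> complex fps \<Rightarrow> complex fps" where
  "cscale a v = fps_const a * v"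

global_interpretation cfps: vector_space cscale
  by unfold_locales (simp_all add: cscale_def algebra_simps flip: fps_const_add fps_const_mult)

definition fbasis :: "real \<Rightarrow> real \<Rightarrow> nat \<Rightarrow> complex fps" where
  "fbasis q l n = fps_const (complex_of_real (fcoef q l n)) * fps_X ^ n"

text \<open>\<open>coord q l v n\<close> is the coefficient of \<open>fbasis q l n\<close> in the expansion of \<open>v\<close>. The Hilbert
  space with orthonormal basis \<open>fbasis q l n\<close> is realised as the weighted $\ell^2$ space of formal
  power series whose coordinate sequence is square summable.\<close>

definition coord :: "real \<Rightarrow> real \<Rightarrow> complex fps \<Rightarrow> nat \<Rightarrow> complex" where
  "coord q l v n = fps_nth v n / complex_of_real (fcoef q l n)"

definition hilb :: "real \<Rightarrow> real \<Rightarrow> complex fps set" where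
  "hilb q l = {v. summable (\<lambda>n. (cmod (coord q l v n))\<^sup>2)}"

definition ip :: "real \<Rightarrow> real \<Rightarrow> complex fps \<Rightarrow> complex fps \<Rightarrow> complex" where
  "ip q l v w = (\<Sum>n. coord q l v n * cnj (coord q l w n))"

definition hnorm :: "real \<Rightarrow> real \<Rightarrow> complex fps \<Rightarrow> real" where
  "hnorm q l v = sqrt (Re (ip q l v v))"

lemma fcoef_pos:
  assumes "0 < q" "q < 1" "0 < l"
  shows "fcoef q l n > 0"
proof -
  have "qpoch a q n > 0" if "0 < a" "a < 1" for a
    unfolding qpoch_def
  proof (rule prod_pos)
    fix r
    have "a * q ^ r \<le> a * 1"
      using that assms by (intro mult_left_mono power_le_one) auto
    then show "0 < 1 - a * q ^ r" using that by linarith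
  qed
  moreover have "q powr (2 * l) < 1"
    using assms powr_less_mono2[of "2 * l" q 1] by simp
  ultimately show ?thesis
    using assms by (simp add: fcoef_def)
qed

lemma coord_fbasis:
  assumes "0 < q" "q < 1" "0 < l"
  shows "coord q l (fbasis q l m) n = (if n = m then 1 else 0)"
  using fcoef_pos[OF assms, of n] by (auto simp: coord_def fbasis_def fps_X_power_nth)

lemma fbasis_in_hilb:
  assumes "0 < q" "q < 1" "0 < l"
  shows "fbasis q l n \<in> hilb q l"
  unfolding hilb_def mem_Collect_eq
  by (rule summable_finite[of "{n}"]) (auto simp: coord_fbasis[OF assms])

lemma fbasis_orthonormal:
  assumes "0 < q" "q < 1" "0 < l"
  shows "ip q l (fbasis q l m) (fbasis q l n) = (if m = n then 1 else 0)"
  unfolding ip_def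
  by (subst suminf_finite[of "{m}"]) (auto simp: coord_fbasis[OF assms])


section \<open>The discrete series operators on the linear span of the basis\<close>

definition fspan :: "real \<Rightarrow> real \<Rightarrow> complex fps set" where
  "fspan q l = cfps.span (range (fbasis q l))"

text \<open>The linear operator on \<^term>\<open>fspan q l\<close> that maps \<^term>\<open>fbasis q l n\<close> to \<open>g n\<close>. On the span
  the index set of the sum is finite.\<close>

definition lin_ext :: "real \<Rightarrow> real \<Rightarrow> (nat \<Rightarrow> complex fps) \<Rightarrow> complex fps \<Rightarrow> complex fps" where
  "lin_ext q l g v = (\<Sum>n | coord q l v n \<noteq> 0. cscale (coord q l v n) (g n))"

lemma lin_ext_fbasis:
  assumes "0 < q" "q < 1" "0 < l"
  shows "lin_ext q l g (fbasis q l m) = g m"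
proof -
  have "{n. coord q l (fbasis q l m) n \<noteq> 0} = {m}"
    by (auto simp: coord_fbasis[OF assms])
  then show ?thesis
    by (simp add: lin_ext_def coord_fbasis[OF assms])
qed

definition Jplus :: "real \<Rightarrow> real \<Rightarrow> complex fps \<Rightarrow> complex fps" where
  "Jplus q l = lin_ext q l (\<lambda>n. cscale
     (complex_of_real (sqrt (qnum q (2 * l + real n) * qnum q (real n + 1)))) (fbasis q l (n + 1)))"

text \<open>For \<open>n = 0\<close> the factor \<^term>\<open>qnum q 0\<close> vanishes, so the truncated index \<open>0 - 1 = 0\<close> is harmless.\<close>

definition Jminus :: "real \<Rightarrow> real \<Rightarrow> complex fps \<Rightarrow> complex fps" where
  "Jminus q l = lin_ext q l (\<lambda>n. cscale
     (complex_of_real (sqrt (qnum q (2 * l + real n - 1) * qnum q (real n)))) (fbasis q l (n - 1)))"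

text \<open>\<open>qJ0 q l c\<close> is $q^{c J_0}$.\<close>

definition qJ0 :: "real \<Rightarrow> real \<Rightarrow> real \<Rightarrow> complex fps \<Rightarrow> complex fps" where
  "qJ0 q l c = lin_ext q l (\<lambda>n. cscale (complex_of_real (q powr (c * (l + real n)))) (fbasis q l n))"

definition I3_span :: "real \<Rightarrow> real \<Rightarrow> complex fps \<Rightarrow> complex fps" where
  "I3_span q l v =
     cscale (- 1 / 2)
       (qJ0 q l (- 3 / 4) (Jplus q l (qJ0 q l (- 3 / 4) v) + Jminus q l (qJ0 q l (- 3 / 4) v)))
     + cscale (complex_of_real ((1 + q) / (2 * (1 - q)))) (qJ0 q l (- 2) v)
     - cscale (complex_of_real ((q powr l + q powr (1 - l)) / (2 * (1 - q)))) (qJ0 q l (- 1) v)"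


section \<open>Unbounded operators\<close>

text \<open>Operators are represented by their graphs.\<close>

type_synonym op_graph = "(complex fps \<times> complex fps) set"

definition linear_op :: "real \<Rightarrow> real \<Rightarrow> op_graph \<Rightarrow> bool" where
  "linear_op q l A \<longleftrightarrow> A \<subseteq> hilb q l \<times> hilb q l \<and> single_valued A \<and> (0, 0) \<in> A \<and>
     (\<forall>(u, u') \<in> A. \<forall>(v, v') \<in> A. (u + v, u' + v') \<in> A) \<and>
     (\<forall>a. \<forall>(u, u') \<in> A. (cscale a u, cscale a u') \<in> A)"

definition op_closure :: "real \<Rightarrow> real \<Rightarrow> op_graph \<Rightarrow> op_graph" where
  "op_closure q l A = {(v, w). v \<in> hilb q l \<and> w \<in> hilb q l \<and>
     (\<exists>u u'. (\<forall>k. (u k, u' k) \<in> A) \<and>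
        (\<lambda>k. hnorm q l (u k - v)) \<longlonglongrightarrow> 0 \<and> (\<lambda>k. hnorm q l (u' k - w)) \<longlonglongrightarrow> 0)}"

definition closed_op :: "real \<Rightarrow> real \<Rightarrow> op_graph \<Rightarrow> bool" where
  "closed_op q l A \<longleftrightarrow> linear_op q l A \<and> op_closure q l A = A"

definition densely_defined :: "real \<Rightarrow> real \<Rightarrow> op_graph \<Rightarrow> bool" where
  "densely_defined q l A \<longleftrightarrow>
     (\<forall>v \<in> hilb q l. \<forall>e > 0. \<exists>u \<in> Domain A. hnorm q l (u - v) < e)"

definition symmetric_op :: "real \<Rightarrow> real \<Rightarrow> op_graph \<Rightarrow> bool" where
  "symmetric_op q l A \<longleftrightarrow> linear_op q l A \<and> densely_defined q l A \<and>
     (\<forall>(u, u') \<in> A. \<forall>(v, v') \<in> A. ip q l u' v = ip q l u v')"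

definition adjoint_op :: "real \<Rightarrow> real \<Rightarrow> op_graph \<Rightarrow> op_graph" where
  "adjoint_op q l A = {(w, z). w \<in> hilb q l \<and> z \<in> hilb q l \<and>
     (\<forall>(u, u') \<in> A. ip q l u' w = ip q l u z)}"

definition selfadjoint_op :: "real \<Rightarrow> real \<Rightarrow> op_graph \<Rightarrow> bool" where
  "selfadjoint_op q l A \<longleftrightarrow> linear_op q l A \<and> densely_defined q l A \<and> adjoint_op q l A = A"

definition eigenspace :: "op_graph \<Rightarrow> complex \<Rightarrow> complex fps set" where
  "eigenspace A z = {v. (v, cscale z v) \<in> A}"

text \<open>Dimensions of the kernels of $A^* - \mathrm{i}$ and $A^* + \mathrm{i}$. The library dimension
  of an infinite-dimensional space is \<open>0\<close>; only positive values are unambiguous.\<close>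

definition deficiency_indices :: "real \<Rightarrow> real \<Rightarrow> op_graph \<Rightarrow> nat \<times> nat" where
  "deficiency_indices q l A =
     (cfps.dim (eigenspace (adjoint_op q l A) \<i>), cfps.dim (eigenspace (adjoint_op q l A) (- \<i>)))"


section \<open>The operator \<open>I3\<close>\<close>

definition I3 :: "real \<Rightarrow> real \<Rightarrow> op_graph" where
  "I3 q l = op_closure q l {(v, I3_span q l v) | v. v \<in> fspan q l}"

end

theory Submission
  imports Defs
begin

text \<open>In the basis \<open>f\<^sub>n\<close> the operator is a Jacobi matrix whose entries grow like \<open>q\<^sup>-\<^sup>2\<^sup>n\<close>, and the
  adjoint of its closure is the same matrix with its maximal domain. Divided by its leading
  coefficient, the eigenvalue recurrence tends, for every eigenvalue, to the recurrence with
  constant coefficients whose characteristic roots are \<open>q\<^sup>1\<^sup>/\<^sup>2\<close> and \<open>q\<^sup>3\<^sup>/\<^sup>2\<close>. Both are less than \<open>1\<close>, so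
  every formal eigenvector is square summable (the limit circle case), and as it is determined by
  its first coordinate, each eigenspace of the adjoint has dimension \<open>1\<close>.\<close>

section \<open>Second order recurrences with convergent coefficients\<close>

text \<open>A Poincare-type perturbation argument with characteristic roots \<open>s\<close> and
  \<open>t\<close> in the limit. The limiting system is triangular in the coordinates
  \<open>d n\<close>, \<open>x n\<close>, so a weighted norm contracts even when
  \<open>s = t\<close>, and the contraction survives small errors in the coefficients.\<close>

lemma square_summable_recurrence:
  fixes x A B :: "nat \<Rightarrow> complex" and s t :: real
  assumes s: "0 \<le> s" "s < 1" and t: "0 \<le> t" "t < 1"
    and rec: "\<And>n. x (n + 2) = A n * x (n + 1) - B n * x n"
    and A: "A \<longlonglongrightarrow> of_real (s + t)" and B: "B \<longlonglongrightarrow> of_real (s * t)"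
  shows "summable (\<lambda>n. (cmod (x n))\<^sup>2)"
proof -
  \<comment> \<open>For the constant coefficients \<open>s + t\<close> and \<open>s * t\<close> the differences \<open>d\<close> satisfy
    \<open>d (n + 1) = s * d n\<close>; weighting \<open>x\<close> by a small \<open>c\<close> makes \<open>N\<close> contract.\<close>
  define m where "m = max s t"
  \<comment> \<open>This makes both \<open>s + 4 * c\<close> and \<open>t + 4 * c\<close> at most 1:
    room for the coupling, for the perturbation and for a remaining contraction by
    \<open>1 - c\<close>.\<close>
  define c where "c = (1 - m) / 4"
  define d where "d n = x (n + 1) - of_real t * x n" for n
  define N where "N n = cmod (d n) + c * cmod (x n)" for n
  define err where "err n = cmod (A n - of_real (s + t)) + cmod (B n - of_real (s * t))" for n
  have m: "s \<le> m" "t \<le> m" "m < 1" and c: "0 < c" "c \<le> 1" "s + c + 2 * c \<le> 1 - c"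
    using s t by (auto simp: m_def c_def max_def field_simps split: if_splits)
  have "err \<longlonglongrightarrow> cmod (of_real (s + t) - of_real (s + t)) + cmod (of_real (s * t) - of_real (s * t))"
    unfolding err_def by (intro tendsto_intros A B)
  then have err0: "err \<longlonglongrightarrow> 0" by simp
  \<comment> \<open>One factor \<open>c\<close> matches the weight of \<open>cmod (x n)\<close> in
    \<open>N\<close>, the other keeps the error small relative to the gap
    \<open>1 - m\<close>.\<close>
  have "\<forall>\<^sub>F n in sequentially. err n < c * c"
    using order_tendstoD(2)[OF err0] c by simp
  then obtain n0 where n0: "\<And>n. n \<ge> n0 \<Longrightarrow> err n < c * c"
    by (auto simp: eventually_sequentially)
  have step: "N (Suc n) \<le> (1 - c) * N n" if "n \<ge> n0" for n
  proof -
    have e: "0 \<le> err n" by (simp add: err_def)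
    have x1: "x (n + 1) = d n + of_real t * x n" by (simp add: d_def)
    \<comment> \<open>The constant-coefficient part acts on \<open>d\<close> as multiplication by
      \<open>s\<close>; only the deviations of \<open>A n\<close> and \<open>B n\<close> from their
      limits remain.\<close>
    have dn: "d (Suc n) = of_real s * d n
        + ((A n - of_real (s + t)) * x (n + 1) - (B n - of_real (s * t)) * x n)"
      using rec[of n] by (simp add: d_def algebra_simps)
    have nx1: "cmod (x (n + 1)) \<le> cmod (d n) + t * cmod (x n)"
      unfolding x1 by (rule order_trans[OF norm_triangle_ineq]) (use t in \<open>simp add: norm_mult\<close>)
    have "cmod ((A n - of_real (s + t)) * x (n + 1) - (B n - of_real (s * t)) * x n)
        \<le> cmod (A n - of_real (s + t)) * cmod (x (n + 1)) + cmod (B n - of_real (s * t)) * cmod (x n)"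
      by (rule order_trans[OF norm_triangle_ineq4]) (simp add: norm_mult)
    also have "\<dots> \<le> err n * cmod (x (n + 1)) + err n * cmod (x n)"
      unfolding err_def by (intro add_mono mult_right_mono) auto
    also have "\<dots> \<le> err n * (cmod (d n) + 2 * cmod (x n))"
    proof -
      have "t * cmod (x n) \<le> cmod (x n)"
        using t by (simp add: mult_left_le_one_le)
      then have "cmod (x (n + 1)) + cmod (x n) \<le> cmod (d n) + 2 * cmod (x n)"
        using nx1 by linarith
      from mult_left_mono[OF this e] show ?thesis by (simp add: algebra_simps)
    qed
    also have "\<dots> \<le> c * c * (cmod (d n) + 2 * cmod (x n))"
      using n0[OF that] by (intro mult_right_mono) auto
    finally have E: "cmod ((A n - of_real (s + t)) * x (n + 1) - (B n - of_real (s * t)) * x n)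
        \<le> c * c * cmod (d n) + 2 * c * c * cmod (x n)"
      by (simp add: algebra_simps)
    have nd: "cmod (d (Suc n)) \<le> s * cmod (d n) + (c * c * cmod (d n) + 2 * c * c * cmod (x n))"
      unfolding dn by (rule order_trans[OF norm_triangle_ineq]) (use s E in \<open>simp add: norm_mult\<close>)
    have "c * cmod (x (Suc n)) \<le> c * (cmod (d n) + t * cmod (x n))"
      using nx1 c by (intro mult_left_mono) auto
    then have "N (Suc n) \<le> (s + c + c * c) * cmod (d n) + c * (t + 2 * c) * cmod (x n)"
      using nd by (simp add: N_def algebra_simps)
    also have "\<dots> \<le> (1 - c) * cmod (d n) + c * (1 - c) * cmod (x n)"
    proof (intro add_mono mult_right_mono mult_left_mono)
      have "c * c \<le> c" using c by (simp add: mult_left_le_one_le)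
      then show "s + c + c * c \<le> 1 - c" using c by linarith
      show "t + 2 * c \<le> 1 - c" using m by (simp add: c_def field_simps)
    qed (use c in auto)
    finally show ?thesis by (simp add: N_def algebra_simps)
  qed
  have N0: "N n \<ge> 0" for n using c by (simp add: N_def)
  have "summable (\<lambda>n. (N n)\<^sup>2)"
  proof (rule summable_ratio_test)
    show "(1 - c)\<^sup>2 < 1"
      using c by (simp add: power2_eq_square mult_left_le_one_le algebra_simps)
    show "norm ((N (Suc n))\<^sup>2) \<le> (1 - c)\<^sup>2 * norm ((N n)\<^sup>2)" if "n \<ge> n0" for n
      using power_mono[OF step[OF that] N0, of 2] by (simp add: power_mult_distrib)
  qed
  then have sm: "summable (\<lambda>n. (N n)\<^sup>2 / c\<^sup>2)" by (rule summable_divide)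
  show ?thesis
  proof (rule summable_comparison_test[OF _ sm], intro exI allI impI)
    fix n
    have "cmod (x n) \<le> N n / c"
      using c by (simp add: N_def field_simps)
    from power_mono[OF this, of 2] show "norm ((cmod (x n))\<^sup>2) \<le> (N n)\<^sup>2 / c\<^sup>2"
      by (simp add: power_divide)
  qed
qed

section \<open>The Hilbert space in coordinates\<close>

lemma coord_add: "coord q l (u + v) n = coord q l u n + coord q l v n"
  by (simp add: coord_def add_divide_distrib)

lemma coord_diff: "coord q l (u - v) n = coord q l u n - coord q l v n"
  by (simp add: coord_def diff_divide_distrib)

lemma coord_cscale: "coord q l (cscale a v) n = a * coord q l v n"
  by (simp add: coord_def cscale_def)

lemma coord_zero [simp]: "coord q l 0 n = 0"
  by (simp add: coord_def)

lemma coord_sum: "coord q l (sum f S) n = (\<Sum>m\<in>S. coord q l (f m) n)"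
  by (simp add: coord_def fps_sum_nth sum_divide_distrib)

locale discrete_series =
  fixes q l :: real
  assumes q0: "0 < q" and q1: "q < 1" and l0: "0 < l"
begin

abbreviation "X \<equiv> coord q l"
abbreviation "H \<equiv> hilb q l"
abbreviation "f \<equiv> fbasis q l"
abbreviation "hn \<equiv> hnorm q l"

lemmas coord_basis = coord_fbasis[OF q0 q1 l0]

lemma fcoef_nonzero: "fcoef q l n \<noteq> 0"
  using fcoef_pos[OF q0 q1 l0, of n] by simp

lemma coord_eqI: "(\<And>n. X u n = X v n) \<Longrightarrow> u = v"
  using fcoef_nonzero by (auto simp: coord_def fps_eq_iff)

definition of_coord :: "(nat \<Rightarrow> complex) \<Rightarrow> complex fps" where
  "of_coord x = Abs_fps (\<lambda>n. x n * complex_of_real (fcoef q l n))"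

lemma coord_of_coord [simp]: "X (of_coord x) n = x n"
  using fcoef_nonzero by (simp add: coord_def of_coord_def)

lemma hilb_iff: "v \<in> H \<longleftrightarrow> summable (\<lambda>n. (cmod (X v n))\<^sup>2)"
  by (simp add: hilb_def)

lemma hilb_cscale: "v \<in> H \<Longrightarrow> cscale a v \<in> H"
  by (simp add: hilb_iff coord_cscale norm_mult power_mult_distrib summable_mult)

lemma hilb_add:
  assumes "u \<in> H" "v \<in> H" shows "u + v \<in> H"
proof -
  have sm: "summable (\<lambda>n. 2 * (cmod (X u n))\<^sup>2 + 2 * (cmod (X v n))\<^sup>2)"
    using assms unfolding hilb_iff by (intro summable_add summable_mult)
  show ?thesis
    unfolding hilb_iff
  proof (rule summable_comparison_test[OF _ sm], intro exI allI impI)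
    fix n
    have "(cmod (X (u + v) n))\<^sup>2 \<le> (cmod (X u n) + cmod (X v n))\<^sup>2"
      unfolding coord_add by (intro power_mono norm_triangle_ineq) simp
    also have "\<dots> \<le> 2 * (cmod (X u n))\<^sup>2 + 2 * (cmod (X v n))\<^sup>2"
      using sum_squares_bound[of "cmod (X u n)" "cmod (X v n)"] by (simp add: power2_sum)
    finally show "norm ((cmod (X (u + v) n))\<^sup>2) \<le> 2 * (cmod (X u n))\<^sup>2 + 2 * (cmod (X v n))\<^sup>2"
      by simp
  qed
qed

lemma hilb_diff:
  assumes "u \<in> H" "v \<in> H" shows "u - v \<in> H"
proof -
  have eq: "u - v = u + cscale (-1) v"
    by (rule coord_eqI) (simp add: coord_add coord_diff coord_cscale)
  show ?thesis
    unfolding eq by (intro hilb_add hilb_cscale assms)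
qed

lemma hnorm_eq:
  assumes "v \<in> H" shows "hn v = sqrt (\<Sum>n. (cmod (X v n))\<^sup>2)"
proof -
  have "(\<lambda>n. complex_of_real ((cmod (X v n))\<^sup>2)) sums of_real (\<Sum>n. (cmod (X v n))\<^sup>2)"
    using assms by (intro sums_of_real) (simp add: hilb_iff summable_sums)
  then have "ip q l v v = of_real (\<Sum>n. (cmod (X v n))\<^sup>2)"
    unfolding ip_def complex_norm_square[symmetric] by (simp add: sums_iff)
  then show ?thesis by (simp add: hnorm_def)
qed

text \<open>Finite sections carry the triangle and Cauchy-Schwarz inequalities of
  \<open>L2_set\<close> over to \<open>hn\<close>.\<close>

lemma L2_set_tendsto_hnorm:
  assumes "v \<in> H" shows "(\<lambda>N. L2_set (\<lambda>n. cmod (X v n)) {..<N}) \<longlonglongrightarrow> hn v"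
  unfolding hnorm_eq[OF assms] L2_set_def
  using assms by (intro tendsto_intros summable_LIMSEQ) (simp add: hilb_iff)

lemma hnorm_nonneg: "v \<in> H \<Longrightarrow> 0 \<le> hn v"
  by (simp add: hnorm_eq suminf_nonneg hilb_iff)

lemma hnorm_zero [simp]: "hn 0 = 0"
  by (simp add: hnorm_def ip_def)

lemma L2_set_le_hnorm:
  assumes "v \<in> H" shows "L2_set (\<lambda>n. cmod (X v n)) {..<N} \<le> hn v"
  unfolding hnorm_eq[OF assms] L2_set_def
  using assms by (auto intro!: sum_le_suminf simp: hilb_iff)

lemma hnorm_triangle:
  assumes "u \<in> H" "v \<in> H" shows "hn (u + v) \<le> hn u + hn v"
proof (rule LIMSEQ_le_const2[OF L2_set_tendsto_hnorm[OF hilb_add[OF assms]]],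
    intro exI allI impI)
  fix N
  have "L2_set (\<lambda>n. cmod (X (u + v) n)) {..<N} \<le> L2_set (\<lambda>n. cmod (X u n) + cmod (X v n)) {..<N}"
    unfolding coord_add by (intro L2_set_mono norm_triangle_ineq) simp
  also have "\<dots> \<le> L2_set (\<lambda>n. cmod (X u n)) {..<N} + L2_set (\<lambda>n. cmod (X v n)) {..<N}"
    by (rule L2_set_triangle_ineq)
  also have "\<dots> \<le> hn u + hn v"
    using assms by (intro add_mono L2_set_le_hnorm)
  finally show "L2_set (\<lambda>n. cmod (X (u + v) n)) {..<N} \<le> hn u + hn v" .
qed

lemma hnorm_cscale:
  assumes "v \<in> H" shows "hn (cscale a v) = cmod a * hn v"
  using assms unfolding hnorm_eq[OF assms] hnorm_eq[OF hilb_cscale[OF assms]]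
  by (simp add: coord_cscale norm_mult power_mult_distrib suminf_mult hilb_iff real_sqrt_mult)

text \<open>Since \<open>ip\<close> is a \<open>suminf\<close>, its algebraic laws need convergence
  of the series; Cauchy-Schwarz on finite sections gives it, together with the bound.\<close>

lemma ip_abs_summable:
  assumes "u \<in> H" "v \<in> H"
  shows "summable (\<lambda>n. cmod (X u n) * cmod (X v n))"
    and "(\<Sum>n. cmod (X u n) * cmod (X v n)) \<le> hn u * hn v"
proof -
  have b: "(\<Sum>n<N. cmod (X u n) * cmod (X v n)) \<le> hn u * hn v" for N
  proof -
    have "(\<Sum>n<N. cmod (X u n) * cmod (X v n))
        \<le> L2_set (\<lambda>n. cmod (X u n)) {..<N} * L2_set (\<lambda>n. cmod (X v n)) {..<N}"
      using L2_set_mult_ineq[of "\<lambda>n. cmod (X u n)" "\<lambda>n. cmod (X v n)" "{..<N}"] by simp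
    also have "\<dots> \<le> hn u * hn v"
      using assms by (intro mult_mono L2_set_le_hnorm) (auto simp: hnorm_nonneg L2_set_nonneg)
    finally show ?thesis .
  qed
  show s: "summable (\<lambda>n. cmod (X u n) * cmod (X v n))"
    by (rule bounded_imp_summable[of _ "hn u * hn v"])
      (use b[of "Suc _"] in \<open>auto simp: lessThan_Suc_atMost\<close>)
  show "(\<Sum>n. cmod (X u n) * cmod (X v n)) \<le> hn u * hn v"
    using b by (intro suminf_le_const s)
qed

lemma ip_sums:
  assumes "u \<in> H" "v \<in> H"
  shows "(\<lambda>n. X u n * cnj (X v n)) sums ip q l u v"
  unfolding ip_def
  using ip_abs_summable(1)[OF assms]
  by (intro summable_sums summable_norm_cancel[where f = "\<lambda>n. X u n * cnj (X v n)"])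
    (simp add: norm_mult)

lemma Cauchy_Schwarz:
  assumes "u \<in> H" "v \<in> H" shows "cmod (ip q l u v) \<le> hn u * hn v"
proof -
  have "cmod (ip q l u v) \<le> (\<Sum>n. cmod (X u n) * cmod (X v n))"
    unfolding ip_def
    using summable_norm[of "\<lambda>n. X u n * cnj (X v n)"] ip_abs_summable(1)[OF assms]
    by (simp add: norm_mult)
  with ip_abs_summable(2)[OF assms] show ?thesis by linarith
qed

lemma ip_diff_left:
  assumes "u \<in> H" "v \<in> H" "w \<in> H"
  shows "ip q l (u - v) w = ip q l u w - ip q l v w"
  using sums_unique2[OF ip_sums[OF hilb_diff[OF assms(1,2)] assms(3)]]
    sums_diff[OF ip_sums[OF assms(1,3)] ip_sums[OF assms(2,3)]]
  by (simp add: coord_diff algebra_simps)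

lemma ip_commute:
  assumes "u \<in> H" "v \<in> H" shows "ip q l v u = cnj (ip q l u v)"
proof (rule sums_unique2[OF ip_sums[OF assms(2,1)]])
  have "(\<lambda>n. cnj (X u n * cnj (X v n))) sums cnj (ip q l u v)"
    using ip_sums[OF assms] by (simp only: sums_cnj)
  then show "(\<lambda>n. X v n * cnj (X u n)) sums cnj (ip q l u v)"
    by (simp add: mult.commute)
qed

lemma ip_cscale_left:
  assumes "u \<in> H" "v \<in> H" shows "ip q l (cscale a u) v = a * ip q l u v"
  by (rule sums_unique2[OF ip_sums[OF hilb_cscale[OF assms(1)] assms(2)]])
    (use sums_mult[OF ip_sums[OF assms], of a] in \<open>simp add: coord_cscale mult.assoc\<close>)

lemma ip_tendsto_left:
  assumes u: "\<And>k. u k \<in> H" and v: "v \<in> H" and w: "w \<in> H"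
    and lim: "(\<lambda>k. hn (u k - v)) \<longlonglongrightarrow> 0"
  shows "(\<lambda>k. ip q l (u k) w) \<longlonglongrightarrow> ip q l v w"
proof (rule LIM_zero_cancel, rule Lim_null_comparison[OF always_eventually])
  show "(\<lambda>k. hn (u k - v) * hn w) \<longlonglongrightarrow> 0"
    by (rule tendsto_mult_left_zero[OF lim])
  show "\<forall>k. norm (ip q l (u k) w - ip q l v w) \<le> hn (u k - v) * hn w"
    using Cauchy_Schwarz[OF hilb_diff[OF u v] w] ip_diff_left[OF u v w] by auto
qed

section \<open>Closures and adjoints of operator graphs\<close>

lemma op_closureI:
  assumes "v \<in> H" "w \<in> H" "\<And>k. (u k, u' k) \<in> A"
    and "(\<lambda>k. hn (u k - v)) \<longlonglongrightarrow> 0" "(\<lambda>k. hn (u' k - w)) \<longlonglongrightarrow> 0"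
  shows "(v, w) \<in> op_closure q l A"
  using assms unfolding op_closure_def by blast

text \<open>The epsilon form of the sequential closure; it spares a diagonal sequence in the proof
  of idempotence.\<close>

lemma op_closure_iff:
  "(v, w) \<in> op_closure q l A \<longleftrightarrow> v \<in> H \<and> w \<in> H \<and>
     (\<forall>e>0. \<exists>(u, u') \<in> A. hn (u - v) < e \<and> hn (u' - w) < e)" if A: "A \<subseteq> H \<times> H"
proof (intro iffI conjI allI impI)
  assume "(v, w) \<in> op_closure q l A"
  then obtain u u' where vw: "v \<in> H" "w \<in> H" and uA: "\<And>k. (u k, u' k) \<in> A"
    and lim: "(\<lambda>k. hn (u k - v)) \<longlonglongrightarrow> 0" "(\<lambda>k. hn (u' k - w)) \<longlonglongrightarrow> 0"
    by (auto simp: op_closure_def)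
  show "v \<in> H" "w \<in> H" by fact+
  fix e :: real assume "e > 0"
  then have "\<forall>\<^sub>F k in sequentially. hn (u k - v) < e \<and> hn (u' k - w) < e"
    using lim by (intro eventually_conj order_tendstoD(2)) auto
  then obtain k where "hn (u k - v) < e \<and> hn (u' k - w) < e"
    by (auto simp: eventually_sequentially)
  then show "\<exists>(u, u') \<in> A. hn (u - v) < e \<and> hn (u' - w) < e"
    using uA by blast
next
  assume R: "v \<in> H \<and> w \<in> H \<and> (\<forall>e>0. \<exists>(u, u') \<in> A. hn (u - v) < e \<and> hn (u' - w) < e)"
  have "\<exists>p. p \<in> A \<and> hn (fst p - v) < inverse (real (Suc k)) \<and> hn (snd p - w) < inverse (real (Suc k))"
    for k
    using R[THEN conjunct2, THEN conjunct2, rule_format, of "inverse (real (Suc k))"] by force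
  then obtain p where p: "\<And>k. p k \<in> A" "\<And>k. hn (fst (p k) - v) < inverse (real (Suc k))"
    "\<And>k. hn (snd (p k) - w) < inverse (real (Suc k))"
    by metis
  have pH: "fst (p k) \<in> H" "snd (p k) \<in> H" for k
    using p(1)[of k] A by (auto simp: mem_Times_iff)
  have lim: "(\<lambda>k. hn (y k - x)) \<longlonglongrightarrow> 0"
    if "\<And>k. y k \<in> H" "x \<in> H" "\<And>k. hn (y k - x) < inverse (real (Suc k))" for y x
    by (rule tendsto_sandwich[OF _ _ tendsto_const LIMSEQ_inverse_real_of_nat];
        intro always_eventually allI)
      (use that in \<open>simp_all add: hnorm_nonneg hilb_diff less_imp_le del: of_nat_Suc\<close>)
  show "(v, w) \<in> op_closure q l A"
    by (rule op_closureI[of v w "\<lambda>k. fst (p k)" "\<lambda>k. snd (p k)"]) (use R p pH in \<open>auto intro!: lim\<close>)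
qed

lemma op_closure_subset: "op_closure q l A \<subseteq> H \<times> H"
  by (auto simp: op_closure_def)

lemma op_closure_increasing:
  assumes "A \<subseteq> H \<times> H" shows "A \<subseteq> op_closure q l A"
proof (rule subrelI)
  fix v w assume vw: "(v, w) \<in> A"
  then show "(v, w) \<in> op_closure q l A"
    unfolding op_closure_iff[OF assms] using assms by (auto intro!: bexI[OF _ vw])
qed

lemma op_closure_idem:
  assumes A: "A \<subseteq> H \<times> H"
  shows "op_closure q l (op_closure q l A) = op_closure q l A"
proof (intro equalityI op_closure_increasing op_closure_subset subrelI)
  fix v w assume "(v, w) \<in> op_closure q l (op_closure q l A)"
  then have vw: "v \<in> H" "w \<in> H"
    and ap: "\<And>e. e > 0 \<Longrightarrow> \<exists>(u, u') \<in> op_closure q l A. hn (u - v) < e \<and> hn (u' - w) < e"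
    unfolding op_closure_iff[OF op_closure_subset] by auto
  show "(v, w) \<in> op_closure q l A"
    unfolding op_closure_iff[OF A]
  proof (intro conjI vw allI impI)
    fix e :: real assume "e > 0"
    then have e: "e / 2 > 0" by simp
    obtain x x' where x: "(x, x') \<in> op_closure q l A" "hn (x - v) < e / 2" "hn (x' - w) < e / 2"
      using ap[OF e] by auto
    then have xH: "x \<in> H" "x' \<in> H" using op_closure_subset by auto
    have "\<exists>(u, u') \<in> A. hn (u - x) < e / 2 \<and> hn (u' - x') < e / 2"
      using x(1) e unfolding op_closure_iff[OF A] by blast
    then obtain u u' where u: "(u, u') \<in> A" "hn (u - x) < e / 2" "hn (u' - x') < e / 2"
      by blast
    then have uH: "u \<in> H" "u' \<in> H" using A by auto
    have "hn (u - v) \<le> hn (u - x) + hn (x - v)"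
      using hnorm_triangle[OF hilb_diff[OF uH(1) xH(1)] hilb_diff[OF xH(1) vw(1)]] by simp
    moreover have "hn (u' - w) \<le> hn (u' - x') + hn (x' - w)"
      using hnorm_triangle[OF hilb_diff[OF uH(2) xH(2)] hilb_diff[OF xH(2) vw(2)]] by simp
    ultimately have "hn (u - v) < e \<and> hn (u' - w) < e"
      using x u by linarith
    then show "\<exists>(u, u') \<in> A. hn (u - v) < e \<and> hn (u' - w) < e"
      using u(1) by blast
  qed
qed

lemma hnorm_add_tendsto:
  assumes "\<And>k. u k \<in> H" "\<And>k. v k \<in> H" "x \<in> H" "y \<in> H"
    and "(\<lambda>k. hn (u k - x)) \<longlonglongrightarrow> 0" "(\<lambda>k. hn (v k - y)) \<longlonglongrightarrow> 0"
  shows "(\<lambda>k. hn (u k + v k - (x + y))) \<longlonglongrightarrow> 0"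
proof (rule tendsto_sandwich[OF _ _ tendsto_const tendsto_add_zero[OF assms(5,6)]];
    intro always_eventually allI)
  show "0 \<le> hn (u k + v k - (x + y))" for k
    using assms by (intro hnorm_nonneg hilb_diff hilb_add)
  show "hn (u k + v k - (x + y)) \<le> hn (u k - x) + hn (v k - y)" for k
    using hnorm_triangle[of "u k - x" "v k - y"] hilb_diff assms by (simp add: algebra_simps)
qed

lemma hnorm_cscale_tendsto:
  assumes "\<And>k. u k \<in> H" "x \<in> H" "(\<lambda>k. hn (u k - x)) \<longlonglongrightarrow> 0"
  shows "(\<lambda>k. hn (cscale a (u k) - cscale a x)) \<longlonglongrightarrow> 0"
proof -
  have "hn (cscale a (u k) - cscale a x) = cmod a * hn (u k - x)" for k
    using hnorm_cscale[OF hilb_diff[OF assms(1,2)]]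
    by (simp add: cfps.scale_right_diff_distrib[symmetric])
  then show ?thesis using tendsto_mult_right_zero[OF assms(3)] by simp
qed

text \<open>The closure of the graph of a linear operator can fail to be a graph, hence the
  assumption \<open>sv\<close>. For \<open>I3\<close> it comes from the inclusion in the
  adjoint.\<close>

lemma linear_op_closure:
  assumes A: "linear_op q l A" and sv: "single_valued (op_closure q l A)"
  shows "linear_op q l (op_closure q l A)"
  unfolding linear_op_def
proof (intro conjI sv op_closure_subset ballI allI; clarsimp?)
  have AH: "A \<subseteq> H \<times> H" and A0: "(0, 0) \<in> A"
    and Aadd: "\<And>u u' v v'. (u, u') \<in> A \<Longrightarrow> (v, v') \<in> A \<Longrightarrow> (u + v, u' + v') \<in> A"
    and Ascale: "\<And>a u u'. (u, u') \<in> A \<Longrightarrow> (cscale a u, cscale a u') \<in> A"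
    using A unfolding linear_op_def by blast+
  show "(0, 0) \<in> op_closure q l A"
    using op_closure_increasing[OF AH] A0 by blast
  fix x x' assume "(x, x') \<in> op_closure q l A"
  then obtain u u' where xH: "x \<in> H" "x' \<in> H" and u: "\<And>k. (u k, u' k) \<in> A"
    and ulim: "(\<lambda>k. hn (u k - x)) \<longlonglongrightarrow> 0" "(\<lambda>k. hn (u' k - x')) \<longlonglongrightarrow> 0"
    by (auto simp: op_closure_def)
  have uH: "u k \<in> H" "u' k \<in> H" for k using u AH by auto
  show "(cscale a x, cscale a x') \<in> op_closure q l A" for a
    by (rule op_closureI[OF hilb_cscale[OF xH(1)] hilb_cscale[OF xH(2)] Ascale[OF u]
          hnorm_cscale_tendsto[OF uH(1) xH(1) ulim(1)] hnorm_cscale_tendsto[OF uH(2) xH(2) ulim(2)]])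
  fix y y' assume "(y, y') \<in> op_closure q l A"
  then obtain v v' where yH: "y \<in> H" "y' \<in> H" and v: "\<And>k. (v k, v' k) \<in> A"
    and vlim: "(\<lambda>k. hn (v k - y)) \<longlonglongrightarrow> 0" "(\<lambda>k. hn (v' k - y')) \<longlonglongrightarrow> 0"
    by (auto simp: op_closure_def)
  have vH: "v k \<in> H" "v' k \<in> H" for k using v AH by auto
  show "(x + y, x' + y') \<in> op_closure q l A"
    by (rule op_closureI[OF hilb_add[OF xH(1) yH(1)] hilb_add[OF xH(2) yH(2)] Aadd[OF u v]
          hnorm_add_tendsto[OF uH(1) vH(1) xH(1) yH(1) ulim(1) vlim(1)]
          hnorm_add_tendsto[OF uH(2) vH(2) xH(2) yH(2) ulim(2) vlim(2)]])
qed

text \<open>Both sides are continuous in the graph norm by Cauchy-Schwarz, so the identity passes to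
  limits of pairs from \<open>A\<close>.\<close>

lemma ip_eq_on_closure:
  assumes A: "A \<subseteq> H \<times> H" and w: "w \<in> H" "z \<in> H"
    and eq: "\<And>u u'. (u, u') \<in> A \<Longrightarrow> ip q l u' w = ip q l u z"
    and x: "(x, x') \<in> op_closure q l A"
  shows "ip q l x' w = ip q l x z"
proof -
  from x obtain u u' where xH: "x \<in> H" "x' \<in> H" and u: "\<And>k. (u k, u' k) \<in> A"
    and ulim: "(\<lambda>k. hn (u k - x)) \<longlonglongrightarrow> 0" "(\<lambda>k. hn (u' k - x')) \<longlonglongrightarrow> 0"
    by (auto simp: op_closure_def)
  have uH: "u k \<in> H" "u' k \<in> H" for k using u A by auto
  have "(\<lambda>k. ip q l (u' k) w) \<longlonglongrightarrow> ip q l x' w"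
    by (rule ip_tendsto_left[OF uH(2) xH(2) w(1) ulim(2)])
  moreover have "(\<lambda>k. ip q l (u k) z) \<longlonglongrightarrow> ip q l x z"
    by (rule ip_tendsto_left[OF uH(1) xH(1) w(2) ulim(1)])
  ultimately show ?thesis
    using LIMSEQ_unique eq[OF u] by simp
qed

text \<open>This reduces the adjoint of \<open>I3\<close> to test vectors of finite support.\<close>

lemma adjoint_closure:
  assumes A: "A \<subseteq> H \<times> H"
  shows "adjoint_op q l (op_closure q l A) = adjoint_op q l A"
proof (intro equalityI subrelI)
  fix w z assume "(w, z) \<in> adjoint_op q l (op_closure q l A)"
  then show "(w, z) \<in> adjoint_op q l A"
    using op_closure_increasing[OF A] unfolding adjoint_op_def by blast
next
  fix w z assume "(w, z) \<in> adjoint_op q l A"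
  then have "w \<in> H" "z \<in> H" "\<And>u u'. (u, u') \<in> A \<Longrightarrow> ip q l u' w = ip q l u z"
    unfolding adjoint_op_def by blast+
  then show "(w, z) \<in> adjoint_op q l (op_closure q l A)"
    using ip_eq_on_closure[OF A] unfolding adjoint_op_def by blast
qed

text \<open>Continuity extends one argument of the symmetry relation to the closure; conjugation
  then moves that argument to the slot tested by the adjoint.\<close>

lemma closure_subset_adjoint:
  assumes A: "A \<subseteq> H \<times> H" and sym: "A \<subseteq> adjoint_op q l A"
  shows "op_closure q l A \<subseteq> adjoint_op q l A"
proof (rule subrelI)
  fix x x' assume x: "(x, x') \<in> op_closure q l A"
  then have xH: "x \<in> H" "x' \<in> H" using op_closure_subset by auto
  have "ip q l v' x = ip q l v x'" if v: "(v, v') \<in> A" for v v'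
  proof -
    have vH: "v \<in> H" "v' \<in> H" using v A by auto
    have "ip q l x' v = ip q l x v'"
      using sym v unfolding adjoint_op_def by (intro ip_eq_on_closure[OF A vH _ x]) blast
    then show ?thesis
      using ip_commute[OF xH(2) vH(1)] ip_commute[OF xH(1) vH(2)] by simp
  qed
  then show "(x, x') \<in> adjoint_op q l A"
    using xH unfolding adjoint_op_def by blast
qed

section \<open>The Jacobi matrix of the operator\<close>

text \<open>The entry linking indices \<open>n\<close> and \<open>n + 1\<close>, up to the sign that
  \<open>jac\<close> supplies. The raising and lowering parts give the same value, so the matrix is
  real symmetric.\<close>

definition offdiag :: "nat \<Rightarrow> real" where
  "offdiag n = 1 / 2 * q powr (- 3 / 4 * (l + real n)) * q powr (- 3 / 4 * (l + real (n + 1)))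
     * sqrt (qnum q (2 * l + real n) * qnum q (real n + 1))"

definition diag :: "nat \<Rightarrow> real" where
  "diag n = (1 + q) / (2 * (1 - q)) * q powr (- 2 * (l + real n))
     - (q powr l + q powr (1 - l)) / (2 * (1 - q)) * q powr (- 1 * (l + real n))"

text \<open>Defined on arbitrary sequences, so that it also describes the adjoint on its maximal
  domain and formal eigenvectors not yet known to be square summable.\<close>

definition jac :: "(nat \<Rightarrow> complex) \<Rightarrow> nat \<Rightarrow> complex" where
  "jac x n = of_real (diag n) * x n - of_real (offdiag n) * x (n + 1)
     - (if n = 0 then 0 else of_real (offdiag (n - 1)) * x (n - 1))"

lemma fspan_iff: "v \<in> fspan q l \<longleftrightarrow> finite {n. X v n \<noteq> 0}"
proof
  have "cfps.subspace {v. finite {n. X v n \<noteq> 0}}"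
    unfolding cfps.subspace_def
  proof (intro conjI ballI allI; simp)
    fix u v assume "finite {n. X u n \<noteq> 0}" "finite {n. X v n \<noteq> 0}"
    then have "finite ({n. X u n \<noteq> 0} \<union> {n. X v n \<noteq> 0})" by simp
    then show "finite {n. X (u + v) n \<noteq> 0}"
      by (rule rev_finite_subset) (auto simp: coord_add)
  next
    fix a v assume "finite {n. X v n \<noteq> 0}"
    then show "finite {n. X (cscale a v) n \<noteq> 0}"
      by (rule rev_finite_subset) (auto simp: coord_cscale)
  qed
  moreover have "range f \<subseteq> {v. finite {n. X v n \<noteq> 0}}"
    by (auto simp: coord_basis)
  ultimately have "fspan q l \<subseteq> {v. finite {n. X v n \<noteq> 0}}"
    unfolding fspan_def by (intro cfps.span_minimal)
  then show "v \<in> fspan q l \<Longrightarrow> finite {n. X v n \<noteq> 0}" by blast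
next
  assume fin: "finite {n. X v n \<noteq> 0}"
  have "v = (\<Sum>n | X v n \<noteq> 0. cscale (X v n) (f n))"
    by (rule coord_eqI) (auto simp: coord_sum coord_cscale coord_basis fin if_distrib[of "(*) _"]
        cong: if_cong)
  also have "\<dots> \<in> fspan q l"
    unfolding fspan_def by (intro cfps.span_sum cfps.span_scale cfps.span_base) auto
  finally show "v \<in> fspan q l" .
qed

lemma fspan_closed:
  "0 \<in> fspan q l" "u \<in> fspan q l \<Longrightarrow> v \<in> fspan q l \<Longrightarrow> u + v \<in> fspan q l"
  "u \<in> fspan q l \<Longrightarrow> v \<in> fspan q l \<Longrightarrow> u - v \<in> fspan q l"
  "v \<in> fspan q l \<Longrightarrow> cscale a v \<in> fspan q l" "f n \<in> fspan q l"
  unfolding fspan_def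
  by (auto intro: cfps.span_zero cfps.span_add cfps.span_diff cfps.span_scale cfps.span_base)

lemma fspan_subset_hilb: "fspan q l \<subseteq> H"
  by (auto simp: fspan_iff hilb_iff intro!: summable_finite)

lemma lin_ext_in_fspan: "(\<And>n. g n \<in> fspan q l) \<Longrightarrow> lin_ext q l g v \<in> fspan q l"
  unfolding lin_ext_def fspan_def by (intro cfps.span_sum cfps.span_scale)

text \<open>The operators are weighted shifts, so at most one basis vector feeds coordinate
  \<open>n\<close>. Finite support of \<open>v\<close> keeps the sum in \<open>lin_ext\<close> from
  taking the default value 0 of an infinite index set.\<close>

lemma coord_lin_ext:
  assumes "v \<in> fspan q l" "\<And>m. m \<noteq> k \<Longrightarrow> X (g m) n = 0"
  shows "X (lin_ext q l g v) n = X v k * X (g k) n"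
proof -
  have "X (lin_ext q l g v) n = (\<Sum>m | X v m \<noteq> 0. if m = k then X v k * X (g k) n else 0)"
    unfolding lin_ext_def coord_sum coord_cscale using assms(2) by (intro sum.cong) auto
  then show ?thesis using assms(1) by (simp add: fspan_iff)
qed

lemma qJ0_in_fspan: "qJ0 q l c v \<in> fspan q l"
  unfolding qJ0_def by (intro lin_ext_in_fspan fspan_closed)

lemma Jplus_in_fspan: "Jplus q l v \<in> fspan q l"
  unfolding Jplus_def by (intro lin_ext_in_fspan fspan_closed)

lemma Jminus_in_fspan: "Jminus q l v \<in> fspan q l"
  unfolding Jminus_def by (intro lin_ext_in_fspan fspan_closed)

lemma coord_qJ0:
  "v \<in> fspan q l \<Longrightarrow> X (qJ0 q l c v) n = of_real (q powr (c * (l + real n))) * X v n"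
  unfolding qJ0_def by (subst coord_lin_ext[where k = n]) (auto simp: coord_cscale coord_basis)

lemma coord_Jplus:
  "v \<in> fspan q l \<Longrightarrow> X (Jplus q l v) n = (if n = 0 then 0 else
     of_real (sqrt (qnum q (2 * l + real (n - 1)) * qnum q (real (n - 1) + 1))) * X v (n - 1))"
  unfolding Jplus_def
  by (subst coord_lin_ext[where k = "n - 1"]) (auto simp: coord_cscale coord_basis)

lemma coord_Jminus:
  assumes "v \<in> fspan q l"
  shows "X (Jminus q l v) n =
     of_real (sqrt (qnum q (2 * l + real n) * qnum q (real n + 1))) * X v (n + 1)"
  unfolding Jminus_def
proof (subst coord_lin_ext[where k = "n + 1"])
  \<comment> \<open>In the case \<open>m = 0\<close>, \<open>n = 0\<close> truncated subtraction
    turns \<open>f (m - 1)\<close> into \<open>f 0\<close>; the coefficient vanishes because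
    \<open>qnum q 0 = 0\<close>.\<close>
  show "X (cscale (of_real (sqrt (qnum q (2 * l + real m - 1) * qnum q (real m)))) (f (m - 1))) n = 0"
    if "m \<noteq> n + 1" for m
    using that by (cases m) (auto simp: coord_cscale coord_basis qnum_def)
qed (auto simp: assms coord_cscale coord_basis add_ac)

lemma I3_span_in_fspan: "I3_span q l v \<in> fspan q l"
  unfolding I3_span_def by (intro fspan_closed qJ0_in_fspan)

lemma coord_I3_span:
  assumes v: "v \<in> fspan q l" shows "X (I3_span q l v) n = jac (X v) n"
proof -
  show ?thesis
    unfolding I3_span_def coord_diff coord_add coord_cscale
    by (cases n) (simp_all add: coord_qJ0 coord_add coord_Jplus coord_Jminus v fspan_closed(2)
      qJ0_in_fspan Jplus_in_fspan Jminus_in_fspan jac_def offdiag_def diag_def algebra_simps)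
qed

lemma jac_cnj: "jac (\<lambda>n. cnj (x n)) n = cnj (jac x n)"
  by (simp add: jac_def)

text \<open>Discrete Green formula: the diagonal terms cancel and the off-diagonal ones telescope to
  a Wronskian boundary term at \<open>M\<close>.\<close>

lemma jac_Green:
  "(\<Sum>n\<le>M. jac x n * y n - x n * jac y n) = of_real (offdiag M) * (x M * y (M + 1) - x (M + 1) * y M)"
  by (induction M) (simp_all add: jac_def algebra_simps)

text \<open>Finite support of \<open>u\<close> kills the boundary term in Green's formula, so
  \<open>w\<close> may be any power series.\<close>

lemma ip_I3_span:
  assumes u: "u \<in> fspan q l"
  shows "ip q l (I3_span q l u) w = (\<Sum>n. X u n * cnj (jac (X w) n))"
proof -
  obtain M where M: "\<And>n. n \<ge> M \<Longrightarrow> X u n = 0"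
    using u unfolding fspan_iff finite_nat_set_iff_bounded by (auto simp: not_less[symmetric])
  \<comment> \<open>Index \<open>M\<close> is included because the matrix can spread the support of
    \<open>u\<close> by one place; the Wronskian at \<open>M\<close> involves only
    \<open>X u M\<close> and \<open>X u (M + 1)\<close>, both 0.\<close>
  have "ip q l (I3_span q l u) w = (\<Sum>n\<le>M. jac (X u) n * cnj (X w n))"
    unfolding ip_def coord_I3_span[OF u] by (rule suminf_finite) (auto simp: jac_def M)
  also have "\<dots> = (\<Sum>n\<le>M. X u n * cnj (jac (X w) n))"
    using jac_Green[of "X u" "\<lambda>n. cnj (X w n)" M] by (simp add: M jac_cnj sum_subtractf)
  also have "\<dots> = (\<Sum>n. X u n * cnj (jac (X w) n))"
    by (rule suminf_finite[symmetric]) (auto simp: M)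
  finally show ?thesis .
qed

section \<open>The minimal operator and its adjoint\<close>

definition I3_core :: op_graph where
  "I3_core = {(v, I3_span q l v) | v. v \<in> fspan q l}"

lemma I3_eq_closure: "I3 q l = op_closure q l I3_core"
  by (simp add: I3_def I3_core_def)

lemma I3_core_subset: "I3_core \<subseteq> H \<times> H"
  using fspan_subset_hilb I3_span_in_fspan by (auto simp: I3_core_def)

text \<open>Testing against the basis vectors reads off each coordinate of \<open>z\<close>, and
  Green's formula gives the converse. No boundary condition at infinity appears: this is the maximal
  operator.\<close>

lemma adjoint_I3_core:
  "adjoint_op q l I3_core = {(w, z). w \<in> H \<and> z \<in> H \<and> (\<forall>n. X z n = jac (X w) n)}"
proof (intro equalityI subrelI)
  fix w z assume wz: "(w, z) \<in> adjoint_op q l I3_core"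
  have "X z m = jac (X w) m" for m
  proof -
    have s: "(\<Sum>n. X (f m) n * cnj (y n)) = cnj (y m)" for y
      by (subst suminf_finite[of "{m}"]) (auto simp: coord_basis)
    have "cnj (jac (X w) m) = ip q l (I3_span q l (f m)) w"
      unfolding ip_I3_span[OF fspan_closed(5)] s ..
    also have "\<dots> = ip q l (f m) z"
      using wz fspan_closed(5) unfolding adjoint_op_def I3_core_def by blast
    also have "\<dots> = cnj (X z m)"
      unfolding ip_def s ..
    finally show ?thesis by simp
  qed
  with wz show "(w, z) \<in> {(w, z). w \<in> H \<and> z \<in> H \<and> (\<forall>n. X z n = jac (X w) n)}"
    by (simp add: adjoint_op_def)
next
  fix w z assume "(w, z) \<in> {(w, z). w \<in> H \<and> z \<in> H \<and> (\<forall>n. X z n = jac (X w) n)}"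
  then show "(w, z) \<in> adjoint_op q l I3_core"
    by (auto simp: adjoint_op_def I3_core_def ip_I3_span[unfolded ip_def] ip_def)
qed

lemma adjoint_I3: "adjoint_op q l (I3 q l) = adjoint_op q l I3_core"
  unfolding I3_eq_closure by (rule adjoint_closure[OF I3_core_subset])

lemma I3_subset_adjoint: "I3 q l \<subseteq> adjoint_op q l (I3 q l)"
  unfolding adjoint_I3 unfolding I3_eq_closure
proof (rule closure_subset_adjoint[OF I3_core_subset])
  show "I3_core \<subseteq> adjoint_op q l I3_core"
    using I3_core_subset unfolding adjoint_I3_core by (auto simp: I3_core_def coord_I3_span)
qed

section \<open>Linearity, closedness and symmetry\<close>

lemma linear_I3_core: "linear_op q l I3_core"
  unfolding linear_op_def
proof (intro conjI I3_core_subset)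
  \<comment> \<open>Additivity is checked in coordinates, since the index set of the sum in
    \<open>lin_ext\<close> depends on the vector.\<close>
  have add: "I3_span q l u + I3_span q l v = I3_span q l (u + v)"
    if "u \<in> fspan q l" "v \<in> fspan q l" for u v
    by (rule coord_eqI)
      (use that in \<open>simp add: coord_add coord_I3_span fspan_closed jac_def algebra_simps\<close>)
  have scale: "cscale a (I3_span q l u) = I3_span q l (cscale a u)" if "u \<in> fspan q l" for a u
    by (rule coord_eqI)
      (use that in \<open>simp add: coord_cscale coord_I3_span fspan_closed jac_def algebra_simps\<close>)
  have "I3_span q l 0 = 0"
    using scale[OF fspan_closed(1), of 0] by (simp add: cscale_def)
  then show "(0, 0) \<in> I3_core"
    using fspan_closed(1) by (auto simp: I3_core_def)
  show "single_valued I3_core"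
    by (auto simp: I3_core_def single_valued_def)
  show "\<forall>(u, u')\<in>I3_core. \<forall>(v, v')\<in>I3_core. (u + v, u' + v') \<in> I3_core"
    by (auto simp: I3_core_def add fspan_closed)
  show "\<forall>a. \<forall>(u, u')\<in>I3_core. (cscale a u, cscale a u') \<in> I3_core"
    by (auto simp: I3_core_def scale fspan_closed)
qed

text \<open>\<open>I3\<close> lies inside its adjoint, where \<open>jac\<close> determines the
  second component of a pair from the first; hence the closure is single valued.\<close>

lemma closed_I3: "closed_op q l (I3 q l)"
proof -
  have "single_valued (I3 q l)"
  proof (intro single_valuedI coord_eqI)
    fix x y z n assume "(x, y) \<in> I3 q l" "(x, z) \<in> I3 q l"
    then have "X y n = jac (X x) n" "X z n = jac (X x) n"
      using I3_subset_adjoint unfolding adjoint_I3 adjoint_I3_core by blast+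
    then show "X y n = X z n" by simp
  qed
  then show ?thesis
    unfolding closed_op_def I3_eq_closure
    by (intro conjI linear_op_closure linear_I3_core op_closure_idem I3_core_subset)
qed

lemma fspan_dense:
  assumes v: "v \<in> H" and e: "e > 0"
  shows "\<exists>u \<in> fspan q l. hn (u - v) < e"
proof -
  have sm: "summable (\<lambda>n. (cmod (X v n))\<^sup>2)" using v by (simp add: hilb_iff)
  obtain N where N: "norm (\<Sum>n. (cmod (X v (n + N)))\<^sup>2) < e\<^sup>2"
    using suminf_exist_split[OF _ sm, of "e\<^sup>2"] e by auto
  define u where "u = of_coord (\<lambda>n. if n < N then X v n else 0)"
  have u: "u \<in> fspan q l" by (auto simp: fspan_iff u_def)
  have uv: "u - v \<in> H" using u fspan_subset_hilb v by (intro hilb_diff) auto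
  have "(\<Sum>n. (cmod (X (u - v) n))\<^sup>2) = (\<Sum>n. (cmod (X (u - v) (n + N)))\<^sup>2)"
    using uv unfolding hilb_iff
    by (subst suminf_split_initial_segment[where k = N]) (auto simp: coord_diff u_def)
  also have "\<dots> = (\<Sum>n. (cmod (X v (n + N)))\<^sup>2)"
    by (simp add: coord_diff u_def)
  also have "\<dots> < e\<^sup>2" using N by simp
  finally have "hn (u - v) < e"
    unfolding hnorm_eq[OF uv] using e by (simp add: real_less_lsqrt)
  then show ?thesis using u by blast
qed

lemma symmetric_I3: "symmetric_op q l (I3 q l)"
  unfolding symmetric_op_def
proof (intro conjI)
  show "linear_op q l (I3 q l)" using closed_I3 by (simp add: closed_op_def)
  have "fspan q l \<subseteq> Domain (I3 q l)"
    using op_closure_increasing[OF I3_core_subset] unfolding I3_eq_closure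
    by (auto simp: I3_core_def)
  then show "densely_defined q l (I3 q l)"
    using fspan_dense unfolding densely_defined_def by blast
  show "\<forall>(u, u')\<in>I3 q l. \<forall>(v, v')\<in>I3 q l. ip q l u' v = ip q l u v'"
    using I3_subset_adjoint unfolding adjoint_op_def by blast
qed

section \<open>Eigenvectors of the adjoint\<close>

lemma qnum_eq: "qnum q c = q powr ((1 - c) / 2) * (1 - q powr c) / (1 - q)"
proof -
  have "q powr (c / 2) - q powr (- c / 2) = - (q powr (- c / 2) * (1 - q powr c))"
    by (simp add: right_diff_distrib flip: powr_add)
  moreover have "q powr (1 / 2) - q powr (- 1 / 2) = - (q powr (- 1 / 2) * (1 - q))"
  proof -
    have "q powr (- 1 / 2) * q = q powr (1 / 2)"
      using q0 powr_add[of q "- 1 / 2" 1] by simp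
    then show ?thesis by (simp add: algebra_simps)
  qed
  moreover have "q powr ((1 - c) / 2) = q powr (- c / 2) / q powr (- 1 / 2)"
    by (simp add: diff_divide_distrib flip: powr_diff)
  ultimately show ?thesis unfolding qnum_def by simp
qed

lemma sqrt_qnum_mult:
  "sqrt (qnum q a * qnum q b)
    = q powr ((1 - a) / 4 + (1 - b) / 4) / (1 - q) * sqrt ((1 - q powr a) * (1 - q powr b))"
proof -
  have "(q powr ((1 - a) / 4 + (1 - b) / 4))\<^sup>2 = q powr ((1 - a) / 2) * q powr ((1 - b) / 2)"
    unfolding power2_eq_square powr_add[symmetric]
    by (rule arg_cong[where f = "(powr) q"]) (simp add: field_simps)
  then have "qnum q a * qnum q b
      = (q powr ((1 - a) / 4 + (1 - b) / 4) / (1 - q))\<^sup>2 * ((1 - q powr a) * (1 - q powr b))"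
    by (simp add: qnum_eq power_divide) (simp add: power2_eq_square)
  then show ?thesis
    using q1 by (simp add: real_sqrt_mult)
qed

text \<open>The common factor of the diagonal and off-diagonal entries after scaling by
  \<open>q ^ (2 * n)\<close>; it cancels in the limits of the recurrence coefficients.\<close>

definition K :: real where "K = q powr (- 2 * l) / (2 * (1 - q))"

lemma K_pos: "K > 0"
  using q0 q1 by (simp add: K_def)

text \<open>When the exponents of \<open>q\<close> are collected, those containing \<open>n\<close>
  cancel and \<open>- 2 * l - 1 / 2\<close> is left; the remaining square root tends to 1.\<close>

lemma offdiag_scaled:
  "offdiag n * q ^ (2 * n) = K * q powr (- 1 / 2) * sqrt ((1 - q powr (2 * l) * q ^ n) * (1 - q * q ^ n))"
proof -
  have p: "q powr (2 * l + real n) = q powr (2 * l) * q ^ n" "q powr (real n + 1) = q * q ^ n"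
    "q ^ (2 * n) = q powr (2 * real n)"
    using q0 by (simp_all add: powr_add powr_realpow flip: powr_realpow)
  have "offdiag n * q ^ (2 * n) =
      q powr (- 3 / 4 * (l + real n)) * q powr (- 3 / 4 * (l + real (n + 1)))
      * q powr ((1 - (2 * l + real n)) / 4 + (1 - (real n + 1)) / 4) * q powr (2 * real n)
      * sqrt ((1 - q powr (2 * l) * q ^ n) * (1 - q * q ^ n)) / (2 * (1 - q))"
    unfolding offdiag_def sqrt_qnum_mult p by simp
  also have "q powr (- 3 / 4 * (l + real n)) * q powr (- 3 / 4 * (l + real (n + 1)))
      * q powr ((1 - (2 * l + real n)) / 4 + (1 - (real n + 1)) / 4) * q powr (2 * real n)
      = q powr (- 2 * l) * q powr (- 1 / 2)"
    unfolding powr_add[symmetric] by (rule arg_cong[where f = "(powr) q"]) (simp add: field_simps)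
  finally show ?thesis by (simp add: K_def)
qed

lemma diag_scaled:
  "diag n * q ^ (2 * n) = K * (1 + q) - (q powr l + q powr (1 - l)) / (2 * (1 - q)) * q powr (- l) * q ^ n"
proof -
  have p: "q ^ (2 * n) = q powr (2 * real n)" "q ^ n = q powr real n"
    using q0 by (simp_all add: flip: powr_realpow)
  have "q powr (- 2 * (l + real n)) * q ^ (2 * n) = q powr (- 2 * l)"
    "q powr (- 1 * (l + real n)) * q ^ (2 * n) = q powr (- l) * q ^ n"
    unfolding p powr_add[symmetric] by (simp_all add: algebra_simps)
  then show ?thesis
    unfolding diag_def K_def left_diff_distrib mult.assoc by simp
qed

text \<open>This lets the eigenvalue equation be solved for the next coordinate, as the divisions in
  \<open>eigseq\<close> require.\<close>

lemma offdiag_nonzero: "offdiag n \<noteq> 0"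
proof -
  have n: "q ^ n \<le> 1" "0 < q ^ n" using q0 q1 by (auto intro: power_le_one)
  have "q powr (2 * l) < 1" using q0 q1 l0 powr_less_mono2[of "2 * l" q 1] by simp
  moreover have "q powr (2 * l) * q ^ n \<le> q powr (2 * l) * 1" "q * q ^ n \<le> q * 1"
    using n q0 by (intro mult_left_mono; simp)+
  ultimately have "1 - q powr (2 * l) * q ^ n > 0" "1 - q * q ^ n > 0" using q1 by linarith+
  then have "offdiag n * q ^ (2 * n) \<noteq> 0" unfolding offdiag_scaled using K_pos q0 by simp
  then show ?thesis by auto
qed

lemma q_power_tendsto_0: "(\<lambda>n. q ^ n) \<longlonglongrightarrow> 0"
  using q0 q1 by (intro LIMSEQ_power_zero) simp

lemma offdiag_scaled_tendsto: "(\<lambda>n. offdiag n * q ^ (2 * n)) \<longlonglongrightarrow> K * q powr (- 1 / 2)"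
proof -
  have "(\<lambda>n. K * q powr (- 1 / 2) * sqrt ((1 - q powr (2 * l) * q ^ n) * (1 - q * q ^ n)))
      \<longlonglongrightarrow> K * q powr (- 1 / 2) * sqrt ((1 - q powr (2 * l) * 0) * (1 - q * 0))"
    by (intro tendsto_intros q_power_tendsto_0)
  then show ?thesis by (simp add: offdiag_scaled)
qed

lemma diag_scaled_tendsto: "(\<lambda>n. diag n * q ^ (2 * n)) \<longlonglongrightarrow> K * (1 + q)"
proof -
  have "(\<lambda>n. K * (1 + q) - (q powr l + q powr (1 - l)) / (2 * (1 - q)) * q powr (- l) * q ^ n)
      \<longlonglongrightarrow> K * (1 + q) - (q powr l + q powr (1 - l)) / (2 * (1 - q)) * q powr (- l) * 0"
    by (intro tendsto_intros q_power_tendsto_0)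
  then show ?thesis by (simp add: diag_scaled)
qed

section \<open>Formal eigenvectors: the orthogonal polynomials of the Jacobi matrix at
  \<open>z\<close>\<close>

fun eigseq :: "complex \<Rightarrow> nat \<Rightarrow> complex" where
  "eigseq z 0 = 1"
| "eigseq z (Suc 0) = (of_real (diag 0) - z) / of_real (offdiag 0)"
| "eigseq z (Suc (Suc n)) = (of_real (diag (Suc n)) - z) / of_real (offdiag (Suc n)) * eigseq z (Suc n)
     - of_real (offdiag n) / of_real (offdiag (Suc n)) * eigseq z n"

lemma jac_eigseq: "jac (eigseq z) n = z * eigseq z n"
  using offdiag_nonzero by (cases n) (auto simp: jac_def field_simps)

text \<open>Row 0 has no lower neighbour, so it fixes \<open>x 1\<close> from \<open>x 0\<close>,
  and each later row fixes the next coordinate. This bounds the multiplicity by 1.\<close>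

lemma jac_eigen_unique:
  assumes "\<And>n. jac x n = z * x n" shows "x n = x 0 * eigseq z n"
proof (induction n rule: induct_nat_012)
  case 0
  show ?case by simp
next
  case 1
  show ?case using assms[of 0] offdiag_nonzero[of 0] by (simp add: jac_def field_simps)
next
  case (ge2 n)
  have "x (Suc (Suc n)) = (of_real (diag (Suc n)) - z) / of_real (offdiag (Suc n)) * x (Suc n)
     - of_real (offdiag n) / of_real (offdiag (Suc n)) * x n"
    using assms[of "Suc n"] offdiag_nonzero[of "Suc n"] by (simp add: jac_def field_simps)
  also have "\<dots> = x 0 * eigseq z (Suc (Suc n))"
    unfolding ge2 by (simp add: algebra_simps)
  finally show ?case .
qed

lemma eigseq_square_summable: "summable (\<lambda>n. (cmod (eigseq z n))\<^sup>2)"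
proof (rule square_summable_recurrence)
  \<comment> \<open>The limiting characteristic polynomial is
    \<open>r^2 - q^(1/2) * (1 + q) * r + q^2\<close>, and these are its roots.\<close>
  let ?s = "q powr (1 / 2)" and ?t = "q powr (3 / 2)"
  show "0 \<le> ?s" "0 \<le> ?t" by auto
  show "?s < 1" "?t < 1"
    using q0 q1 powr_less_mono2[of _ q 1] by simp_all
  show "eigseq z (n + 2) = (of_real (diag (Suc n)) - z) / of_real (offdiag (Suc n)) * eigseq z (n + 1)
     - of_real (offdiag n) / of_real (offdiag (Suc n)) * eigseq z n" for n
    by simp
  have nz: "complex_of_real (K * q powr (- 1 / 2)) \<noteq> 0" using K_pos q0 by simp
  have qn: "q ^ n \<noteq> 0" for n using q0 by simp
  have st: "?s + ?t = K * (1 + q) / (K * q powr (- 1 / 2))" "?s * ?t = q ^ 2"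
  proof -
    have "q powr (- 1 / 2) * ?s = 1" "q powr (- 1 / 2) * ?t = q"
      using q0 by (simp_all flip: powr_add)
    then have "(?s + ?t) * q powr (- 1 / 2) = 1 + q" by (simp add: algebra_simps)
    then show "?s + ?t = K * (1 + q) / (K * q powr (- 1 / 2))"
      using K_pos q0 by (simp add: field_simps)
    show "?s * ?t = q ^ 2" using q0 by (simp flip: powr_add)
  qed
  \<comment> \<open>Numerator and denominator are scaled by \<open>q ^ (2 * n)\<close>. This makes
    the entries converge and sends the \<open>z\<close> term to 0, so the limit is the same for
    every \<open>z\<close>.\<close>
  have "(\<lambda>n. (of_real (diag n * q ^ (2 * n)) - z * of_real (q ^ n * q ^ n)) / of_real (offdiag n * q ^ (2 * n)))
      \<longlonglongrightarrow> (of_real (K * (1 + q)) - z * of_real (0 * 0)) / of_real (K * q powr (- 1 / 2))"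
    by (intro tendsto_intros diag_scaled_tendsto offdiag_scaled_tendsto q_power_tendsto_0 nz)
  also have "(\<lambda>n. (of_real (diag n * q ^ (2 * n)) - z * of_real (q ^ n * q ^ n)) / of_real (offdiag n * q ^ (2 * n)))
      = (\<lambda>n. (of_real (diag n) - z) / of_real (offdiag n))"
    using qn offdiag_nonzero by (auto simp: fun_eq_iff field_simps power_mult power2_eq_square power_mult_distrib)
  finally show "(\<lambda>n. (of_real (diag (Suc n)) - z) / of_real (offdiag (Suc n))) \<longlonglongrightarrow> of_real (?s + ?t)"
    unfolding st(1) using K_pos by (intro LIMSEQ_Suc) simp
  \<comment> \<open>Consecutive entries carry scalings that differ by \<open>q ^ 2\<close>; this
    factor is the limit of the ratio.\<close>
  have "(\<lambda>n. (offdiag n * q ^ (2 * n)) / (offdiag (Suc n) * q ^ (2 * Suc n)) * q ^ 2)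
      \<longlonglongrightarrow> (K * q powr (- 1 / 2)) / (K * q powr (- 1 / 2)) * q ^ 2"
    using nz by (intro tendsto_intros offdiag_scaled_tendsto LIMSEQ_Suc[OF offdiag_scaled_tendsto]) auto
  also have "(\<lambda>n. (offdiag n * q ^ (2 * n)) / (offdiag (Suc n) * q ^ (2 * Suc n)) * q ^ 2) = (\<lambda>n. offdiag n / offdiag (Suc n))"
    using q0 offdiag_nonzero by (auto simp: fun_eq_iff field_simps power2_eq_square)
  finally have "(\<lambda>n. offdiag n / offdiag (Suc n)) \<longlonglongrightarrow> ?s * ?t"
    unfolding st(2) using K_pos q0 by simp
  from tendsto_of_real[OF this, where 'a = complex]
  show "(\<lambda>n. of_real (offdiag n) / of_real (offdiag (Suc n))) \<longlonglongrightarrow> complex_of_real (?s * ?t)"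
    by simp
qed

section \<open>Deficiency spaces and failure of selfadjointness\<close>

lemma eigenspace_adjoint_I3:
  "eigenspace (adjoint_op q l (I3 q l)) z = cfps.span {of_coord (eigseq z)}"
proof (intro equalityI subsetI)
  fix v assume "v \<in> eigenspace (adjoint_op q l (I3 q l)) z"
  then have "\<And>n. jac (X v) n = z * X v n"
    unfolding eigenspace_def adjoint_I3 adjoint_I3_core by (auto simp: coord_cscale)
  then have "v = cscale (X v 0) (of_coord (eigseq z))"
    by (intro coord_eqI) (simp add: coord_cscale flip: jac_eigen_unique)
  then show "v \<in> cfps.span {of_coord (eigseq z)}"
    by (auto simp: cfps.span_singleton)
next
  fix v assume "v \<in> cfps.span {of_coord (eigseq z)}"
  then obtain a where v: "v = cscale a (of_coord (eigseq z))"
    by (auto simp: cfps.span_singleton)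
  have "of_coord (eigseq z) \<in> H" by (simp add: hilb_iff eigseq_square_summable)
  then have "v \<in> H" "cscale z v \<in> H" by (simp_all add: v hilb_cscale)
  moreover have "X (cscale z v) n = jac (X v) n" for n
  proof -
    have "jac (X v) n = a * jac (eigseq z) n"
      by (simp add: jac_def v coord_cscale algebra_simps)
    then show ?thesis by (simp add: v coord_cscale jac_eigseq)
  qed
  ultimately show "v \<in> eigenspace (adjoint_op q l (I3 q l)) z"
    unfolding eigenspace_def adjoint_I3 adjoint_I3_core by auto
qed

lemma of_coord_eigseq_nonzero: "of_coord (eigseq z) \<noteq> 0"
proof
  assume "of_coord (eigseq z) = 0"
  then have "X (of_coord (eigseq z)) 0 = 0" by simp
  then show False by simp
qed

lemma dim_eigenspace_adjoint_I3: "cfps.dim (eigenspace (adjoint_op q l (I3 q l)) z) = 1"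
proof -
  have "cfps.independent {of_coord (eigseq z)}"
    using of_coord_eigseq_nonzero by (simp add: cfps.dependent_single)
  then show ?thesis
    unfolding eigenspace_adjoint_I3 cfps.dim_span by (simp add: cfps.dim_eq_card_independent)
qed

text \<open>A selfadjoint operator has no nonzero eigenvector for the nonreal eigenvalue
  \<open>\<i>\<close>, but the adjoint of \<open>I3\<close> has one.\<close>

lemma not_selfadjoint_I3: "\<not> selfadjoint_op q l (I3 q l)"
proof
  assume "selfadjoint_op q l (I3 q l)"
  then have adj: "adjoint_op q l (I3 q l) = I3 q l" by (simp add: selfadjoint_op_def)
  define p where "p = of_coord (eigseq \<i>)"
  have "p \<in> eigenspace (adjoint_op q l (I3 q l)) \<i>"
    unfolding eigenspace_adjoint_I3 p_def by (simp add: cfps.span_base)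
  then have pI: "(p, cscale \<i> p) \<in> adjoint_op q l (I3 q l)"
    by (simp add: eigenspace_def)
  then have pH: "p \<in> H" by (simp add: adjoint_op_def)
  \<comment> \<open>The pair is used twice: as a member of the adjoint and, under the assumption, as
    a member of \<open>I3\<close> itself.\<close>
  have "ip q l (cscale \<i> p) p = ip q l p (cscale \<i> p)"
    using pI pI[unfolded adj] unfolding adjoint_op_def by blast
  also have "\<dots> = cnj (ip q l (cscale \<i> p) p)"
    using pH by (intro ip_commute hilb_cscale)
  finally have "\<i> * ip q l p p = cnj (\<i> * ip q l p p)"
    using pH by (simp add: ip_cscale_left)
  then have "Re (ip q l p p) = 0" by (simp add: complex_eq_iff)
  then have "hn p = 0" by (simp add: hnorm_def)
  \<comment> \<open>The normalisation \<open>eigseq \<i> 0 = 1\<close> forces the norm of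
    \<open>p\<close> to be at least 1.\<close>
  moreover have "L2_set (\<lambda>n. cmod (X p n)) {..<1} = 1"
    by (simp add: L2_set_def p_def)
  ultimately show False using L2_set_le_hnorm[OF pH, of 1] by simp
qed

end

theorem mainTheorem5:
  fixes q l :: real
  assumes "0 < q" and "q < 1" and "0 < l"
  shows "closed_op q l (I3 q l) \<and> symmetric_op q l (I3 q l) \<and>
    \<not> selfadjoint_op q l (I3 q l) \<and> deficiency_indices q l (I3 q l) = (1, 1)"
proof -
  interpret discrete_series q l
    by unfold_locales (fact assms)+
  show ?thesis
    using closed_I3 symmetric_I3 not_selfadjoint_I3
    by (simp add: deficiency_indices_def dim_eigenspace_adjoint_I3)
qed

end
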